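(* Let $h\in\mathbb{N}$, let $\alpha>0$, $\rho>0$ be real numbers, let $\hat{\mathbf{p}}_d\in\mathbb{R}^h$, let $C_e,C_b:\mathbb{R}^h\to\mathbb{R}_+$ be cost functions, and let $\mathcal{P}_e,\mathcal{P}_b\subset\mathbb{R}^h$ be polytopes. The iterative scheme (for $t=0,1,2,\dots$) $$\mathbf{y}_e^{t+1}=\mathbf{p}_e^t+\mathbf{u}_e^t+\mathbf{a}^t,\qquad \mathbf{y}_b^{t+1}=\mathbf{p}_b^t+\mathbf{u}_b^t+\mathbf{a}^t,$$ $$\mathbf{p}_e^{t+1}=\operatorname*{arg\,min}_{\mathbf{p}_e\in\mathcal{P}_e}\left\{C_e(\mathbf{p}_e)+\frac{\rho}{2}\|\mathbf{p}_e-\mathbf{y}_e^{t+1}+\mathbf{u}_e^t\|_2^2\right\},$$ $$\mathbf{p}_b^{t+1}=\operatorname*{arg\,min}_{\mathbf{p}_b\in\mathcal{P}_b}\left\{C_b(\mathbf{p}_b)+\frac{\rho}{2}\|\mathbf{p}_b-\mathbf{y}_b^{t+1}+\mathbf{u}_b^t\|_2^2\right\},$$ $$\mathbf{u}_e^{t+1}=\mathbf{u}_e^t+\mathbf{p}_e^{t+1}-\mathbf{y}_e^{t+1},\qquad \mathbf{u}_b^{t+1}=\mathbf{u}_b^t+\mathbf{p}_b^{t+1}-\mathbf{y}_b^{t+1},$$ with $\mathbf{a}^t=\frac{\alpha}{2\alpha+\rho}\left(\hat{\mathbf{p}}_d-(\mathbf{p}_e^t+\mathbf{p}_b^t+\mathbf{u}_e^t+\mathbf{u}_b^t)\right)$,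 is equivalent, under the substitution $\mathbf{z}_e^t=\mathbf{p}_e^t+\mathbf{u}_e^t$ and $\mathbf{z}_b^t=\mathbf{p}_b^t+\mathbf{u}_b^t$, to the dynamic updates $$\mathbf{p}_e^{t+1}=\operatorname*{arg\,min}_{\mathbf{p}_e\in\mathcal{P}_e}\left\{C_e(\mathbf{p}_e)+\frac{\rho}{2}\|\mathbf{p}_e-\mathbf{p}_e^t-\mathbf{a}^t\|_2^2\right\},\qquad \mathbf{z}_e^{t+1}=2\mathbf{p}_e^{t+1}-\mathbf{p}_e^t-\mathbf{a}^t,$$ $$\mathbf{p}_b^{t+1}=\operatorname*{arg\,min}_{\mathbf{p}_b\in\mathcal{P}_b}\left\{C_b(\mathbf{p}_b)+\frac{\rho}{2}\|\mathbf{p}_b-\mathbf{p}_b^t-\mathbf{a}^t\|_2^2\right\},\qquad \mathbf{z}_b^{t+1}=2\mathbf{p}_b^{t+1}-\mathbf{p}_b^t-\mathbf{a}^t,$$ $$\mathbf{a}^t=\frac{\alpha}{2\alpha+\rho}\left(\hat{\mathbf{p}}_d-\mathbf{z}_e^t-\mathbf{z}_b^t\right).$$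
   Context: The superscript $t$ is an iteration index (not a power), and the subscripts $e$, $b$ refer to the engine and battery. All vectors $\mathbf{y}_e^t,\mathbf{y}_b^t,\mathbf{p}_e^t,\mathbf{p}_b^t,\mathbf{u}_e^t,\mathbf{u}_b^t,\mathbf{z}_e^t,\mathbf{z}_b^t,\mathbf{a}^t$ lie in $\mathbb{R}^h$, and $\|\cdot\|_2$ is the Euclidean norm. A polytope means a set of the form $\{\mathbf{x}\in\mathbb{R}^h : A_i\mathbf{x}\preceq\mathbf{b}_i,\ A_e\mathbf{x}=\mathbf{b}_e\}$, with $\preceq$ the componentwise inequality. An equation $\mathbf{p}=\operatorname{arg\,min}\{\cdots\}$ means that $\mathbf{p}$ is the minimizer of the indicated problem. Equivalence of the two schemes means: for sequences $(\mathbf{p}_e^t,\mathbf{p}_b^t,\mathbf{u}_e^t,\mathbf{u}_b^t)_{t\ge 0}$ and $\mathbf{z}_e^t=\mathbf{p}_e^t+\mathbf{u}_e^t$, $\mathbf{z}_b^t=\mathbf{p}_b^t+\mathbf{u}_b^t$, the first scheme holds (for some sequences $\mathbf{y}_e^{t+1},\mathbf{y}_b^{t+1}$) if and only if the second scheme holds. *)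

theory Defs
  imports "HOL-Analysis.Analysis"
begin

text \<open>
  Solution set of finitely many linear inequalities and equations. The row vectors
  \<open>Ai k\<close> (\<open>k < m\<close>) and \<open>Ae k\<close> (\<open>k < n\<close>) are the rows of the two
  constraint matrices. The set need not be bounded, so this is not the library's
  \<^const>\<open>polytope\<close> (the convex hull of a finite set).
\<close>

definition linear_polytope :: "(real ^ 'h) set \<Rightarrow> bool" where
  "linear_polytope P \<longleftrightarrow>
     (\<exists>(m::nat) (n::nat) (Ai :: nat \<Rightarrow> real ^ 'h) (bi :: nat \<Rightarrow> real)
       (Ae :: nat \<Rightarrow> real ^ 'h) (be :: nat \<Rightarrow> real).
       P = {x. (\<forall>k<m. Ai k \<bullet> x \<le> bi k) \<and> (\<forall>k<n. Ae k \<bullet> x = be k)})"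

text \<open>
  Renders \<open>x = argmin {f y | y \<in> S}\<close>, read as: \<open>x\<close> is the (one and only) minimizer of
  \<open>f\<close> over \<open>S\<close>. An equation with the choice operator \<^const>\<open>arg_min\<close> would be
  satisfiable even when no minimizer exists.
\<close>

definition is_the_minimizer :: "('a \<Rightarrow> real) \<Rightarrow> 'a set \<Rightarrow> 'a \<Rightarrow> bool" where
  "is_the_minimizer f S x \<longleftrightarrow>
     is_arg_min f (\<lambda>y. y \<in> S) x \<and> (\<forall>y. is_arg_min f (\<lambda>y. y \<in> S) y \<longrightarrow> y = x)"

text \<open>All sequences are indexed by the iteration; \<open>y_e 0\<close> and \<open>y_b 0\<close> are unconstrained.\<close>

definition admm_scheme ::
  "real \<Rightarrow> real \<Rightarrow> real ^ 'h \<Rightarrow> (real ^ 'h \<Rightarrow> real) \<Rightarrow> (real ^ 'h \<Rightarrow> real) \<Rightarrow>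
   (real ^ 'h) set \<Rightarrow> (real ^ 'h) set \<Rightarrow>
   (nat \<Rightarrow> real ^ 'h) \<Rightarrow> (nat \<Rightarrow> real ^ 'h) \<Rightarrow> (nat \<Rightarrow> real ^ 'h) \<Rightarrow> (nat \<Rightarrow> real ^ 'h) \<Rightarrow>
   (nat \<Rightarrow> real ^ 'h) \<Rightarrow> (nat \<Rightarrow> real ^ 'h) \<Rightarrow> (nat \<Rightarrow> real ^ 'h) \<Rightarrow> bool" where
  "admm_scheme \<alpha> \<rho> pd C_e C_b P_e P_b p_e p_b u_e u_b y_e y_b a \<longleftrightarrow>
     (\<forall>t.
        a t = (\<alpha> / (2 * \<alpha> + \<rho>)) *\<^sub>R (pd - (p_e t + p_b t + u_e t + u_b t)) \<and>
        y_e (Suc t) = p_e t + u_e t + a t \<and>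
        y_b (Suc t) = p_b t + u_b t + a t \<and>
        is_the_minimizer (\<lambda>p. C_e p + \<rho> / 2 * (norm (p - y_e (Suc t) + u_e t))\<^sup>2) P_e (p_e (Suc t)) \<and>
        is_the_minimizer (\<lambda>p. C_b p + \<rho> / 2 * (norm (p - y_b (Suc t) + u_b t))\<^sup>2) P_b (p_b (Suc t)) \<and>
        u_e (Suc t) = u_e t + p_e (Suc t) - y_e (Suc t) \<and>
        u_b (Suc t) = u_b t + p_b (Suc t) - y_b (Suc t))"

definition dynamic_updates ::
  "real \<Rightarrow> real \<Rightarrow> real ^ 'h \<Rightarrow> (real ^ 'h \<Rightarrow> real) \<Rightarrow> (real ^ 'h \<Rightarrow> real) \<Rightarrow>
   (real ^ 'h) set \<Rightarrow> (real ^ 'h) set \<Rightarrow>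
   (nat \<Rightarrow> real ^ 'h) \<Rightarrow> (nat \<Rightarrow> real ^ 'h) \<Rightarrow> (nat \<Rightarrow> real ^ 'h) \<Rightarrow> (nat \<Rightarrow> real ^ 'h) \<Rightarrow>
   (nat \<Rightarrow> real ^ 'h) \<Rightarrow> bool" where
  "dynamic_updates \<alpha> \<rho> pd C_e C_b P_e P_b p_e p_b z_e z_b a \<longleftrightarrow>
     (\<forall>t.
        is_the_minimizer (\<lambda>p. C_e p + \<rho> / 2 * (norm (p - p_e t - a t))\<^sup>2) P_e (p_e (Suc t)) \<and>
        z_e (Suc t) = 2 *\<^sub>R p_e (Suc t) - p_e t - a t \<and>
        is_the_minimizer (\<lambda>p. C_b p + \<rho> / 2 * (norm (p - p_b t - a t))\<^sup>2) P_b (p_b (Suc t)) \<and>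
        z_b (Suc t) = 2 *\<^sub>R p_b (Suc t) - p_b t - a t \<and>
        a t = (\<alpha> / (2 * \<alpha> + \<rho>)) *\<^sub>R (pd - z_e t - z_b t))"

end

theory Submission imports Defs begin

text \<open>
  The vector \<open>y\<close> is only an intermediate quantity: within one iteration it is
  \<open>p + u + a\<close>, so \<open>y - u = p + a\<close>, and the scaled dual variable \<open>u\<close> cancels from the
  centre of the proximal problem. It cancels again from the dual update, which becomes
  \<open>u' = p' - p - a\<close>; adding \<open>p'\<close> turns this into \<open>z' = 2 p' - p - a\<close>, and
  \<open>z = p + u\<close> makes the two formulas for \<open>a\<close> agree. Every step is reversible, and any
  sequences \<open>p\<close>, \<open>u\<close>, \<open>a\<close> admit a \<open>y\<close> with the required values, so the
  equivalence is an iteration-by-iteration rewriting.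
\<close>

lemma dual_cancels_in_proximal_centre:
  fixes x y p u a :: "'a::real_normed_vector"
  assumes "y = p + u + a"
  shows "x - y + u = x - p - a"
  using assms by simp

text \<open>
  The dual update of one agent, rewritten in \<open>z = p + u\<close>. This is an equivalence because
  \<open>u'\<close> and \<open>z'\<close> determine each other once \<open>p'\<close> is given.
\<close>

lemma dual_update_iff_z_update:
  fixes y p u a p' u' z' :: "'a::real_normed_vector"
  assumes "y = p + u + a" and "z' = p' + u'"
  shows "u' = u + p' - y \<longleftrightarrow> z' = 2 *\<^sub>R p' - p - a"
  using assms by (auto simp: scaleR_2 algebra_simps)

theorem proposition1:
  fixes \<alpha> \<rho> :: real
    and pd :: "real ^ 'h"
    and C_e C_b :: "real ^ 'h \<Rightarrow> real"
    and P_e P_b :: "(real ^ 'h) set"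
    and p_e p_b u_e u_b z_e z_b a :: "nat \<Rightarrow> real ^ 'h"
  assumes "\<alpha> > 0" and "\<rho> > 0"
    and "\<And>x. C_e x \<ge> 0" and "\<And>x. C_b x \<ge> 0"
    and "linear_polytope P_e" and "linear_polytope P_b"
    and "\<And>t. z_e t = p_e t + u_e t" and "\<And>t. z_b t = p_b t + u_b t"
  shows "(\<exists>y_e y_b. admm_scheme \<alpha> \<rho> pd C_e C_b P_e P_b p_e p_b u_e u_b y_e y_b a) \<longleftrightarrow>
         dynamic_updates \<alpha> \<rho> pd C_e C_b P_e P_b p_e p_b z_e z_b a"
proof -
  have a_eq: "pd - (p_e t + p_b t + u_e t + u_b t) = pd - z_e t - z_b t" for t
    by (simp add: assms(7,8))
  have iff: "admm_scheme \<alpha> \<rho> pd C_e C_b P_e P_b p_e p_b u_e u_b y_e y_b a \<longleftrightarrow>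
      dynamic_updates \<alpha> \<rho> pd C_e C_b P_e P_b p_e p_b z_e z_b a"
    if y: "\<And>t. y_e (Suc t) = p_e t + u_e t + a t" "\<And>t. y_b (Suc t) = p_b t + u_b t + a t"
    for y_e y_b
    unfolding admm_scheme_def dynamic_updates_def a_eq
      dual_cancels_in_proximal_centre[OF y(1)] dual_cancels_in_proximal_centre[OF y(2)]
      dual_update_iff_z_update[OF y(1) assms(7)]
      dual_update_iff_z_update[OF y(2) assms(8)]
    using y by blast
  show ?thesis
  proof
    assume "\<exists>y_e y_b. admm_scheme \<alpha> \<rho> pd C_e C_b P_e P_b p_e p_b u_e u_b y_e y_b a"
    then obtain y_e y_b
      where admm: "admm_scheme \<alpha> \<rho> pd C_e C_b P_e P_b p_e p_b u_e u_b y_e y_b a"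
      by blast
    then have "y_e (Suc t) = p_e t + u_e t + a t" "y_b (Suc t) = p_b t + u_b t + a t" for t
      unfolding admm_scheme_def by blast+
    then show "dynamic_updates \<alpha> \<rho> pd C_e C_b P_e P_b p_e p_b z_e z_b a"
      using admm iff by blast
  next
    assume dyn: "dynamic_updates \<alpha> \<rho> pd C_e C_b P_e P_b p_e p_b z_e z_b a"
    \<comment> \<open>The shift by \<open>t - 1\<close> matches \<open>y (Suc t)\<close> with the data of iteration \<open>t\<close>;
        the value at \<open>0\<close> is arbitrary.\<close>
    define y_e where "y_e t = p_e (t - 1) + u_e (t - 1) + a (t - 1)" for t
    define y_b where "y_b t = p_b (t - 1) + u_b (t - 1) + a (t - 1)" for t
    have "admm_scheme \<alpha> \<rho> pd C_e C_b P_e P_b p_e p_b u_e u_b y_e y_b a"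
      using dyn by (subst iff) (simp_all add: y_e_def y_b_def)
    then show "\<exists>y_e y_b. admm_scheme \<alpha> \<rho> pd C_e C_b P_e P_b p_e p_b u_e u_b y_e y_b a"
      by blast
  qed
qed

end
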